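(* A tree $G$ is a graph of two parallel paths if and only if all of the following are true: (1) no vertex of $G$ has degree $4$ or greater; (2) $G$ has at most two vertices of degree $3$; and (3) vertices of degree $3$ are adjacent in $G$ (that is, any two distinct vertices of degree $3$ are adjacent).
   Context: Graphs are finite, simple and undirected. A graph $G$ on $n$ vertices is a graph of two parallel paths if there exist two vertex-disjoint induced paths $v_1\dots v_k$ and $u_1\dots u_\ell$ in $G$ with $k+\ell=n$ such that whenever $v_iu_j\in E(G)$, $v_xu_y$ is not an edge when $x>i,\ y<j$ or $x<i,\ y>j$. By convention this includes the case that $G$ is a path $P_n$. *)

theory Defs
  imports "Graph_Theory.Graph_Theory"
begin

text \<open>
  A finite simple undirected graph is a \<^locale>\<open>pair_graph\<close>: a finite, loop-free,
  symmetric digraph without parallel arcs. Each undirected edge is represented by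
  its two orientations, so the degree of a vertex is its out-degree.
\<close>

abbreviation adjacent :: "'a pair_pre_digraph \<Rightarrow> 'a \<Rightarrow> 'a \<Rightarrow> bool" where
  "adjacent G u v \<equiv> (u, v) \<in> parcs G"

definition vertex_degree :: "'a pair_pre_digraph \<Rightarrow> 'a \<Rightarrow> nat" where
  "vertex_degree G v = out_degree (with_proj G) v"

text \<open>
  \<^const>\<open>forest\<close> and \<^const>\<open>tree\<close> count the closed walk \<open>a, b, a\<close> as a
  cycle, so no symmetric graph with an edge satisfies them. Undirected cycles are
  the cycles with at least three arcs. \<^const>\<open>Digraph_Component.connected\<close>
  requires the vertex set to be nonempty.
\<close>

definition undirected_tree :: "'a pair_pre_digraph \<Rightarrow> bool" where
  "undirected_tree G \<longleftrightarrow>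
     Digraph_Component.connected (with_proj G) \<and>
     \<not> (\<exists>c. pre_digraph.cycle (with_proj G) c \<and> 3 \<le> length c)"

text \<open>
  A path is the nonempty list of its vertices, indexed from 0; a single vertex is a
  path. It is induced if all edges of the graph between its vertices are path edges.
\<close>

definition induced_path :: "'a pair_pre_digraph \<Rightarrow> 'a list \<Rightarrow> bool" where
  "induced_path G vs \<longleftrightarrow>
     vpath vs (with_proj G) \<and>
     (\<forall>i<length vs. \<forall>j<length vs.
        adjacent G (vs ! i) (vs ! j) \<longrightarrow> j = Suc i \<or> i = Suc j)"

definition path_graph :: "'a pair_pre_digraph \<Rightarrow> bool" where
  "path_graph G \<longleftrightarrow> (\<exists>vs. induced_path G vs \<and> set vs = pverts G)"

definition noncrossing :: "'a pair_pre_digraph \<Rightarrow> 'a list \<Rightarrow> 'a list \<Rightarrow> bool" where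
  "noncrossing G vs us \<longleftrightarrow>
     (\<forall>i<length vs. \<forall>j<length us. adjacent G (vs ! i) (us ! j) \<longrightarrow>
        (\<forall>x<length vs. \<forall>y<length us.
           x > i \<and> y < j \<or> x < i \<and> y > j \<longrightarrow> \<not> adjacent G (vs ! x) (us ! y)))"

text \<open>
  Since paths are nonempty, the case of a single path covering the graph is the
  separate disjunct \<^const>\<open>path_graph\<close>; it is needed for the one-vertex graph.
\<close>

definition two_parallel_paths :: "'a pair_pre_digraph \<Rightarrow> bool" where
  "two_parallel_paths G \<longleftrightarrow>
     path_graph G \<or>
     (\<exists>vs us. induced_path G vs \<and> induced_path G us \<and>
        set vs \<inter> set us = {} \<and>
        length vs + length us = card (pverts G) \<and>
        noncrossing G vs us)"

end

theory Submission
  imports Defs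
begin

text \<open>
  In a tree, two disjoint paths are joined by at most one edge, since two joining edges
  would close up to a cycle through both paths (\<open>unique_crossing_edge\<close>). So if two paths
  cover the tree, a vertex has at most two neighbours on its own path and at most one on the
  other, and only the two ends of the joining edge can have degree three.

  Conversely, if no degree exceeds three and all vertices of degree three are among the ends
  of one edge \<open>uv\<close>, deleting \<open>uv\<close> leaves a graph of maximum degree two. There a longest path
  through \<open>u\<close> cannot be left by any edge: an edge leaving at an end would extend it, and
  an edge leaving at an inner vertex would be a third one there (\<open>closed_path_exists\<close>).
  The same holds for \<open>v\<close>. The two paths are disjoint, as otherwise \<open>uv\<close> would be a chord of
  a path of the tree; they cover the tree, which is connected; and they are induced, because
  a chord of a path closes a cycle (\<open>circuit_free_chordless\<close>). As \<open>uv\<close> is the only edge between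
  them, nothing crosses. If there is no vertex of degree three, a longest path of
  the tree itself covers it.
\<close>

section \<open>Paths of a binary relation\<close>

definition path_in :: "'a rel \<Rightarrow> 'a list \<Rightarrow> bool" where
  "path_in E xs \<longleftrightarrow> xs \<noteq> [] \<and> distinct xs \<and> successively (\<lambda>x y. (x, y) \<in> E) xs"

text \<open>
  A cycle is represented by a path together with an edge back to its start. Paths with two
  vertices are exempt because in a symmetric relation every edge is such a path.
\<close>

definition circuit_free :: "'a rel \<Rightarrow> bool" where
  "circuit_free E \<longleftrightarrow> (\<forall>xs. path_in E xs \<and> (last xs, hd xs) \<in> E \<longrightarrow> length xs \<le> 2)"

lemma path_in_nth:
  assumes "path_in E xs" "Suc i < length xs"
  shows "(xs ! i, xs ! Suc i) \<in> E"
  using assms by (simp add: path_in_def successively_conv_nth)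

lemma path_in_mono: "path_in E xs \<Longrightarrow> E \<subseteq> F \<Longrightarrow> path_in F xs"
  unfolding path_in_def by (auto elim: successively_mono)

lemma path_in_rev:
  assumes "path_in E xs" "sym E"
  shows "path_in E (rev xs)"
proof -
  have "(y, x) \<in> E \<longleftrightarrow> (x, y) \<in> E" for x y
    using assms(2) by (auto dest: symD)
  then show ?thesis
    using assms(1) by (simp add: path_in_def)
qed

lemma path_in_slice:
  assumes "path_in E xs" "i \<le> j" "j < length xs"
  obtains ys where "path_in E ys" "hd ys = xs ! i" "last ys = xs ! j"
    "set ys \<subseteq> set xs" "length ys = Suc j - i"
proof
  let ?ys = "drop i (take (Suc j) xs)"
  have split: "xs = take i xs @ ?ys @ drop (Suc j) xs"
    using assms(2) by (metis append.assoc append_take_drop_id le_SucI min.absorb1 take_take)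
  have succ: "successively (\<lambda>x y. (x, y) \<in> E) (take i xs @ ?ys @ drop (Suc j) xs)"
    using assms(1) split by (simp add: path_in_def)
  have ne: "?ys \<noteq> []"
    using assms by simp
  show "path_in E ?ys"
    using succ ne assms(1) by (auto simp: path_in_def successively_append_iff)
  show "hd ?ys = xs ! i"
    using assms by (simp add: hd_drop_conv_nth)
  show "last ?ys = xs ! j"
    using assms by (simp add: take_Suc_conv_app_nth)
  show "set ?ys \<subseteq> set xs"
    by (meson order_trans set_drop_subset set_take_subset)
  show "length ?ys = Suc j - i"
    using assms by simp
qed

lemma path_in_between:
  assumes "path_in E xs" "sym E" "a \<in> set xs" "b \<in> set xs"
  obtains ys where "path_in E ys" "hd ys = a" "last ys = b" "set ys \<subseteq> set xs"
proof -
  obtain i j where ij: "i < length xs" "xs ! i = a" "j < length xs" "xs ! j = b"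
    using assms(3,4) by (auto simp: in_set_conv_nth)
  show ?thesis
  proof (cases "i \<le> j")
    case True
    then show ?thesis
      using path_in_slice[OF assms(1) True ij(3)] ij that by metis
  next
    case False
    then obtain ys where ys: "path_in E ys" "hd ys = b" "last ys = a" "set ys \<subseteq> set xs"
      using path_in_slice[OF assms(1), of j i] ij by (metis nat_le_linear)
    then have "ys \<noteq> []"
      by (simp add: path_in_def)
    then show ?thesis
      using that[of "rev ys"] path_in_rev[OF ys(1) assms(2)] ys by (simp add: hd_rev last_rev)
  qed
qed

text \<open>
  The part of the path between the ends of a chord would form a cycle with it.
\<close>

lemma circuit_free_chordless:
  assumes "circuit_free E" "sym E" "irrefl E" "path_in E xs"
    and "i < length xs" "j < length xs" "(xs ! i, xs ! j) \<in> E"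
  shows "j = Suc i \<or> i = Suc j"
proof -
  have consecutive: "l = Suc k"
    if kl: "k < l" "l < length xs" and edge: "(xs ! l, xs ! k) \<in> E" for k l
  proof -
    obtain ys where "path_in E ys" "hd ys = xs ! k" "last ys = xs ! l" "length ys = Suc l - k"
      using path_in_slice[OF assms(4), of k l] kl by auto
    then have "Suc l - k \<le> 2"
      using assms(1) edge unfolding circuit_free_def by metis
    then show ?thesis
      using kl by linarith
  qed
  have "i \<noteq> j"
    using assms(3,7) by (auto simp: irrefl_def)
  then show ?thesis
    using consecutive[of i j] consecutive[of j i] assms(2,5-7)
    by (meson linorder_neqE_nat symD)
qed

text \<open>
  Two crossing edges together with the segments of the two paths between their ends would
  form a cycle, unless they coincide.
\<close>

lemma unique_crossing_edge:
  assumes "circuit_free E" "sym E" "path_in E vs" "path_in E us" "set vs \<inter> set us = {}"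
    and "a \<in> set vs" "b \<in> set us" "(a, b) \<in> E"
    and "a' \<in> set vs" "b' \<in> set us" "(a', b') \<in> E"
  shows "a' = a \<and> b' = b"
proof -
  obtain ps where ps: "path_in E ps" "hd ps = a" "last ps = a'" "set ps \<subseteq> set vs"
    using path_in_between[OF assms(3,2,6,9)] .
  obtain qs where qs: "path_in E qs" "hd qs = b'" "last qs = b" "set qs \<subseteq> set us"
    using path_in_between[OF assms(4,2,10,7)] .
  have ne: "ps \<noteq> []" "qs \<noteq> []"
    using ps(1) qs(1) by (auto simp: path_in_def)
  have "path_in E (ps @ qs)"
    using ps qs assms(5,11) ne unfolding path_in_def
    by (auto simp: successively_append_iff)
  moreover have "(last (ps @ qs), hd (ps @ qs)) \<in> E"
    using ps(2) qs(3) ne assms(2,8) by (auto dest: symD)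
  ultimately have "length (ps @ qs) \<le> 2"
    using assms(1) unfolding circuit_free_def by blast
  then have "length ps = 1" "length qs = 1"
    using ne by (cases ps; cases qs; simp)+
  then show ?thesis
    using ps(2,3) qs(2,3) by (auto simp: length_Suc_conv)
qed

text \<open>
  A longest path through \<open>u\<close> is closed: an edge leaving it at an end would extend it,
  and at an inner vertex the two path edges exhaust the degree.
\<close>

lemma closed_path_exists:
  assumes "finite V" "E \<subseteq> V \<times> V" "sym E" "u \<in> V"
    and degree: "\<And>x. x \<in> V \<Longrightarrow> card (E `` {x}) \<le> 2"
  obtains xs where "path_in E xs" "set xs \<subseteq> V" "u \<in> set xs" "E `` set xs \<subseteq> set xs"
proof -
  define P where "P xs \<longleftrightarrow> path_in E xs \<and> set xs \<subseteq> V \<and> u \<in> set xs" for xs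
  have "P [u]"
    using assms(4) by (simp add: P_def path_in_def)
  moreover have "length xs < Suc (card V)" if "P xs" for xs
    using that card_mono[OF assms(1), of "set xs"]
    by (simp add: P_def path_in_def distinct_card)
  ultimately obtain xs where xs: "P xs" and longest: "\<And>ys. P ys \<Longrightarrow> length ys \<le> length xs"
    using ex_has_greatest_nat[of P "[u]" length "Suc (card V)"] by blast
  have path: "path_in E xs" and ne: "xs \<noteq> []" and dist: "distinct xs"
    using xs by (auto simp: P_def path_in_def)
  have "y \<in> set xs" if x: "x \<in> set xs" and xy: "(x, y) \<in> E" for x y
  proof (rule ccontr)
    assume y: "y \<notin> set xs"
    have yV: "y \<in> V" and xV: "x \<in> V" and yx: "(y, x) \<in> E"
      using x xy assms(2,3) by (auto dest: symD)
    obtain i where i: "i < length xs" "xs ! i = x"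
      using x by (auto simp: in_set_conv_nth)
    consider "i = 0" | "i = length xs - 1" | "0 < i" "Suc i < length xs"
      using i(1) by linarith
    then show False
    proof cases
      case 1
      then have "P (y # xs)"
        using xs y yV yx i ne by (cases xs) (auto simp: P_def path_in_def)
      then show False
        using longest[of "y # xs"] by simp
    next
      case 2
      then have "last xs = x"
        using i ne by (simp add: last_conv_nth)
      then have "P (xs @ [y])"
        using xs y yV xy by (auto simp: P_def path_in_def successively_append_iff)
      then show False
        using longest[of "xs @ [y]"] by simp
    next
      case 3
      let ?p = "xs ! (i - 1)" and ?q = "xs ! Suc i"
      have "(?p, x) \<in> E" "(x, ?q) \<in> E"
        using path_in_nth[OF path, of "i - 1"] path_in_nth[OF path, of i] 3 i by auto
      then have "{?p, ?q, y} \<subseteq> E `` {x}"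
        using xy assms(3) by (auto dest: symD)
      moreover have "finite (E `` {x})"
        using assms(1,2) by (auto intro: finite_subset[of _ V])
      ultimately have "card {?p, ?q, y} \<le> 2"
        using degree[OF xV] card_mono[of "E `` {x}" "{?p, ?q, y}"] by linarith
      moreover have "?p \<noteq> ?q"
        using dist 3 i(1) nth_eq_iff_index_eq[of xs "i - 1" "Suc i"] by linarith
      moreover have "?p \<in> set xs" "?q \<in> set xs"
        using 3 i(1) by auto
      then have "?p \<noteq> y" "?q \<noteq> y"
        using y by auto
      ultimately show False
        by simp
    qed
  qed
  then show ?thesis
    using that[of xs] xs by (auto simp: P_def)
qed

text \<open>
  With two closed paths in the role of \<open>xs\<close> and \<open>C\<close>, this shows that they are equal or
  disjoint as sets.
\<close>

lemma path_in_subset_closed: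
  assumes "path_in E xs" "sym E" "w \<in> set xs" "w \<in> C" "E `` C \<subseteq> C"
  shows "set xs \<subseteq> C"
proof
  fix x assume "x \<in> set xs"
  then obtain ys where ys: "path_in E ys" "hd ys = w" "last ys = x"
    using path_in_between[OF assms(1,2,3)] by metis
  have "ys ! k \<in> C" if "k < length ys" for k
    using that
  proof (induction k)
    case 0
    then show ?case
      using ys(2) assms(4) by (simp add: hd_conv_nth)
  next
    case (Suc k)
    then show ?case
      using path_in_nth[OF ys(1), of k] assms(5) by auto
  qed
  then show "x \<in> C"
    using ys(1,3) by (auto simp: path_in_def last_conv_nth)
qed

section \<open>Trees and their induced paths\<close>

lemma vwalk_arcs_subset_iff:
  "set (vwalk_arcs xs) \<subseteq> E \<longleftrightarrow> successively (\<lambda>x y. (x, y) \<in> E) xs"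
  by (induction xs rule: vwalk_arcs.induct) auto

lemma vpath_iff_path_in:
  "vpath xs (with_proj G) \<longleftrightarrow> path_in (parcs G) xs \<and> set xs \<subseteq> pverts G"
  by (auto simp: vpath_def vwalk_def path_in_def vwalk_arcs_subset_iff)

lemma vertex_degree_eq_card_neighbours: "vertex_degree G v = card (parcs G `` {v})"
proof -
  have "out_arcs (with_proj G) v = Pair v ` (parcs G `` {v})"
    by (auto simp: out_arcs_def)
  then show ?thesis
    by (simp add: vertex_degree_def out_degree_def card_image inj_on_def)
qed

lemma pawalk_verts_vwalk_arcs: "xs \<noteq> [] \<Longrightarrow> pawalk_verts (hd xs) (vwalk_arcs xs) = xs"
  by (induction xs rule: vwalk_arcs.induct) auto

lemma pcas_vwalk_arcs: "xs \<noteq> [] \<Longrightarrow> pcas (hd xs) (vwalk_arcs xs) (last xs)"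
  by (induction xs rule: vwalk_arcs.induct) auto

lemma undirected_tree_circuit_free:
  assumes "pair_graph G" "undirected_tree G"
  shows "circuit_free (parcs G)"
  unfolding circuit_free_def
proof (intro allI impI)
  interpret pair_graph G by fact
  fix xs assume xs: "path_in (parcs G) xs \<and> (last xs, hd xs) \<in> parcs G"
  let ?ys = "xs @ [hd xs]"
  let ?c = "vwalk_arcs ?ys"
  have ne: "xs \<noteq> []" and dist: "distinct xs"
    using xs by (auto simp: path_in_def)
  have len: "length ?c = length xs"
    using vwalk_length_simp[of ?ys] by (simp only: vwalk_length_def) simp
  have "set ?c \<subseteq> parcs G"
    using xs ne by (auto simp: vwalk_arcs_subset_iff path_in_def successively_append_iff)
  moreover have "hd xs \<in> pverts G"
    using xs by (auto dest: in_arcsD2)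
  moreover have "pcas (hd xs) ?c (hd xs)"
    using pcas_vwalk_arcs[of ?ys] ne by simp
  moreover have "pawalk_verts (hd xs) ?c = ?ys"
    using pawalk_verts_vwalk_arcs[of ?ys] ne by simp
  moreover have "distinct (tl ?ys)"
    using dist ne by (cases xs) auto
  moreover have "?c \<noteq> []"
    using len ne by auto
  ultimately have "pre_digraph.cycle (with_proj G) ?c"
    unfolding cycle_def awalk_def by auto
  then have "\<not> 3 \<le> length ?c"
    using assms(2) unfolding undirected_tree_def by blast
  then show "length xs \<le> 2"
    using len by simp
qed

lemma undirected_tree_connected:
  assumes "pair_graph G" "undirected_tree G"
    and "u \<in> C" "u \<in> pverts G" "parcs G `` C \<subseteq> C"
  shows "pverts G \<subseteq> C"
proof
  interpret pair_graph G by fact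
  fix v assume v: "v \<in> pverts G"
  have "strongly_connected (with_proj G)"
    using assms(2) symmetric_connected_imp_strongly_connected[OF pair_sym_arcs]
    by (simp add: undirected_tree_def)
  then have "u \<rightarrow>\<^sup>*\<^bsub>with_proj G\<^esub> v"
    using v assms(4) by (auto simp: strongly_connected_def)
  then have "(u, v) \<in> (parcs G)\<^sup>*"
    using reachable_rtranclI[of "with_proj G" u v] by simp
  then show "v \<in> C"
    using assms(3,5) by (induction rule: rtrancl_induct) auto
qed

lemma pair_graph_sym_irrefl:
  assumes "pair_graph G"
  shows "sym (parcs G)" "irrefl (parcs G)"
proof -
  interpret pair_graph G by fact
  show "sym (parcs G)"
    using pair_sym_arcs by (simp add: symmetric_def)
  show "irrefl (parcs G)"
    by (auto simp: irrefl_def dest: no_loops')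
qed

lemma tree_path_induced:
  assumes "pair_graph G" "undirected_tree G" "path_in (parcs G) xs" "set xs \<subseteq> pverts G"
  shows "induced_path G xs"
  unfolding induced_path_def vpath_iff_path_in
  using assms(3,4) circuit_free_chordless[OF undirected_tree_circuit_free[OF assms(1,2)]
      pair_graph_sym_irrefl[OF assms(1)] assms(3)]
  by blast

lemma induced_path_neighbours:
  assumes "induced_path G xs" "x \<in> set xs"
  shows "card (parcs G `` {x} \<inter> set xs) \<le> 2"
proof -
  obtain i where i: "i < length xs" "xs ! i = x"
    using assms(2) by (auto simp: in_set_conv_nth)
  have "parcs G `` {x} \<inter> set xs \<subseteq> {xs ! (i - 1), xs ! Suc i}"
  proof
    fix y assume y: "y \<in> parcs G `` {x} \<inter> set xs"
    then obtain j where j: "j < length xs" "xs ! j = y"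
      by (auto simp: in_set_conv_nth)
    then have "j = Suc i \<or> i = Suc j"
      using assms(1) i y unfolding induced_path_def by auto
    then show "y \<in> {xs ! (i - 1), xs ! Suc i}"
      using j by auto
  qed
  then have "card (parcs G `` {x} \<inter> set xs) \<le> card {xs ! (i - 1), xs ! Suc i}"
    by (intro card_mono) auto
  also have "\<dots> \<le> 2"
    by (simp add: card_insert_if)
  finally show ?thesis .
qed

section \<open>Degrees in a tree of two parallel paths\<close>

lemma path_graph_degree_le_2:
  assumes "pair_graph G" "path_graph G" "x \<in> pverts G"
  shows "vertex_degree G x \<le> 2"
proof -
  interpret pair_graph G by fact
  obtain vs where vs: "induced_path G vs" "set vs = pverts G"
    using assms(2) by (auto simp: path_graph_def)
  have "parcs G `` {x} \<inter> set vs = parcs G `` {x}"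
    using vs(2) by (auto dest: in_arcsD2)
  then show ?thesis
    using induced_path_neighbours[OF vs(1), of x] vs(2) assms(3)
    by (simp add: vertex_degree_eq_card_neighbours)
qed

text \<open>
  An induced path gives each of its vertices at most two neighbours, so a third one needs a
  crossing edge. The edge \<open>(a, b)\<close> of the second alternative is the only crossing edge; the
  first alternative is the outcome when there is none.
\<close>

lemma two_covering_paths_degrees:
  assumes "pair_graph G" "undirected_tree G"
    and "induced_path G vs" "induced_path G us" "set vs \<inter> set us = {}"
    and "set vs \<union> set us = pverts G"
  shows "(\<forall>x\<in>pverts G. vertex_degree G x \<le> 2) \<or>
    (\<exists>a b. (a, b) \<in> parcs G \<and> (\<forall>x\<in>pverts G. vertex_degree G x \<le> 3) \<and>
       {x \<in> pverts G. vertex_degree G x = 3} \<subseteq> {a, b})"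
proof -
  interpret pair_graph G by fact
  let ?E = "parcs G"
  note sym = pair_graph_sym_irrefl(1)[OF assms(1)]
  have nb: "?E `` {x} = (?E `` {x} \<inter> set vs) \<union> (?E `` {x} \<inter> set us)" for x
    using assms(6) by (auto dest: in_arcsD2)
  have own: "card (?E `` {x} \<inter> set vs) \<le> 2" if "x \<in> set vs" for x
    using induced_path_neighbours[OF assms(3) that] .
  have own': "card (?E `` {x} \<inter> set us) \<le> 2" if "x \<in> set us" for x
    using induced_path_neighbours[OF assms(4) that] .
  show ?thesis
  proof (cases "\<exists>a\<in>set vs. \<exists>b\<in>set us. (a, b) \<in> ?E")
    case False
    have "vertex_degree G x \<le> 2" if "x \<in> pverts G" for x
    proof (cases "x \<in> set vs")
      case True
      then have "?E `` {x} = ?E `` {x} \<inter> set vs"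
        using nb[of x] False by auto
      then show ?thesis
        using own[OF True] by (simp add: vertex_degree_eq_card_neighbours)
    next
      case x: False
      then have "x \<in> set us"
        using that assms(6) by auto
      moreover have "?E `` {x} = ?E `` {x} \<inter> set us"
        using nb[of x] False \<open>x \<in> set us\<close> sym by (auto dest: symD)
      ultimately show ?thesis
        using own'[of x] by (simp add: vertex_degree_eq_card_neighbours)
    qed
    then show ?thesis
      by blast
  next
    case True
    then obtain a b where ab: "a \<in> set vs" "b \<in> set us" "(a, b) \<in> ?E"
      by blast
    have paths: "path_in ?E vs" "path_in ?E us"
      using assms(3,4) by (auto simp: induced_path_def vpath_iff_path_in)
    have unique: "x = a \<and> y = b" if "x \<in> set vs" "y \<in> set us" "(x, y) \<in> ?E" for x y
      using unique_crossing_edge[OF undirected_tree_circuit_free[OF assms(1,2)] sym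
          paths assms(5) ab that] .
    have deg: "vertex_degree G x \<le> 3 \<and> (vertex_degree G x = 3 \<longrightarrow> x \<in> {a, b})"
      if x: "x \<in> pverts G" for x
    proof (cases "x \<in> set vs")
      case True
      have sub: "?E `` {x} \<inter> set us \<subseteq> (if x = a then {b} else {})"
        using unique[OF True] by auto
      then have "card (?E `` {x} \<inter> set us) \<le> (if x = a then 1 else 0)"
        using card_mono[OF _ sub] by (auto split: if_splits)
      then show ?thesis
        using own[OF True] card_Un_le[of "?E `` {x} \<inter> set vs" "?E `` {x} \<inter> set us"] nb[of x]
        by (auto simp: vertex_degree_eq_card_neighbours split: if_splits)
    next
      case False
      then have xu: "x \<in> set us"
        using x assms(6) by auto
      have sub: "?E `` {x} \<inter> set vs \<subseteq> (if x = b then {a} else {})"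
        using unique[OF _ xu] sym by (auto dest: symD)
      then have "card (?E `` {x} \<inter> set vs) \<le> (if x = b then 1 else 0)"
        using card_mono[OF _ sub] by (auto split: if_splits)
      then show ?thesis
        using own'[OF xu] card_Un_le[of "?E `` {x} \<inter> set vs" "?E `` {x} \<inter> set us"] nb[of x]
        by (auto simp: vertex_degree_eq_card_neighbours split: if_splits)
    qed
    then show ?thesis
      using ab(3) by blast
  qed
qed

lemma two_parallel_paths_degrees:
  assumes "pair_graph G" "undirected_tree G" "two_parallel_paths G"
  shows "(\<forall>x\<in>pverts G. vertex_degree G x \<le> 2) \<or>
    (\<exists>a b. (a, b) \<in> parcs G \<and> (\<forall>x\<in>pverts G. vertex_degree G x \<le> 3) \<and>
       {x \<in> pverts G. vertex_degree G x = 3} \<subseteq> {a, b})"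
proof (cases "path_graph G")
  case True
  then show ?thesis
    using path_graph_degree_le_2[OF assms(1)] by blast
next
  case False
  interpret pair_graph G by fact
  obtain vs us where p: "induced_path G vs" "induced_path G us" "set vs \<inter> set us = {}"
    and len: "length vs + length us = card (pverts G)"
    using assms(3) False unfolding two_parallel_paths_def by blast
  have sub: "set vs \<union> set us \<subseteq> pverts G" and "distinct vs" "distinct us"
    using p(1,2) by (auto simp: induced_path_def vpath_iff_path_in path_in_def)
  then have "card (set vs \<union> set us) = card (pverts G)"
    using len p(3) by (simp add: card_Un_disjoint distinct_card)
  then have "set vs \<union> set us = pverts G"
    using sub pair_finite_verts by (simp add: card_subset_eq)
  then show ?thesis
    using two_covering_paths_degrees[OF assms(1,2) p] by blast
qed

section \<open>Two parallel paths from the degree conditions\<close>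

lemma tree_degree_le_2_path_graph:
  assumes "pair_graph G" "undirected_tree G"
    and "\<And>x. x \<in> pverts G \<Longrightarrow> vertex_degree G x \<le> 2"
  shows "path_graph G"
proof -
  interpret pair_graph G by fact
  have "strongly_connected (with_proj G)"
    using assms(2) symmetric_connected_imp_strongly_connected[OF pair_sym_arcs]
    by (simp add: undirected_tree_def)
  then obtain u where u: "u \<in> pverts G"
    by (auto simp: strongly_connected_def)
  have "parcs G \<subseteq> pverts G \<times> pverts G"
    by (auto dest: in_arcsD1 in_arcsD2)
  then obtain xs where xs: "path_in (parcs G) xs" "set xs \<subseteq> pverts G" "u \<in> set xs"
    "parcs G `` set xs \<subseteq> set xs"
    using closed_path_exists[OF pair_finite_verts _ pair_graph_sym_irrefl(1)[OF assms(1)] u]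
      assms(3) by (auto simp: vertex_degree_eq_card_neighbours)
  have "induced_path G xs"
    using tree_path_induced[OF assms(1,2) xs(1,2)] .
  moreover have "set xs = pverts G"
    using undirected_tree_connected[OF assms(1,2) xs(3) u xs(4)] xs(2) by blast
  ultimately show ?thesis
    by (auto simp: path_graph_def)
qed

text \<open>
  The two parallel paths are the components of \<open>u\<close> and \<open>v\<close> after deleting the edge between
  them, which is also the only edge left to cross from one to the other.
\<close>

lemma tree_degree_3_on_edge_two_parallel_paths:
  assumes "pair_graph G" "undirected_tree G" "(u, v) \<in> parcs G"
    and le_3: "\<And>x. x \<in> pverts G \<Longrightarrow> vertex_degree G x \<le> 3"
    and ends: "\<And>x. x \<in> pverts G \<Longrightarrow> vertex_degree G x = 3 \<Longrightarrow> x = u \<or> x = v"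
  shows "two_parallel_paths G"
proof -
  interpret pair_graph G by fact
  let ?E = "parcs G"
  define H where "H = ?E - {(u, v), (v, u)}"
  note sym = pair_graph_sym_irrefl(1)[OF assms(1)]
  have uv: "u \<in> pverts G" "v \<in> pverts G" "(v, u) \<in> ?E"
    using assms(3) sym by (auto dest: in_arcsD1 in_arcsD2 symD)
  have HV: "H \<subseteq> pverts G \<times> pverts G"
    by (auto simp: H_def dest: in_arcsD1 in_arcsD2)
  have H_sym: "sym H"
    using sym by (auto simp: H_def sym_def)
  have H_degree: "card (H `` {x}) \<le> 2" if x: "x \<in> pverts G" for x
  proof -
    have fin: "finite (?E `` {x})"
      by (rule finite_subset[OF _ pair_finite_verts]) (auto dest: in_arcsD2)
    show ?thesis
    proof (cases "x = u \<or> x = v")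
      case True
      then have "H `` {x} \<subset> ?E `` {x}"
        using assms(3) uv(3) by (auto simp: H_def)
      then have "card (H `` {x}) < card (?E `` {x})"
        using fin by (rule psubset_card_mono[rotated])
      then show ?thesis
        using le_3[OF x] by (simp add: vertex_degree_eq_card_neighbours)
    next
      case False
      then have "card (?E `` {x}) \<le> 2"
        using le_3[OF x] ends[OF x] by (fastforce simp: vertex_degree_eq_card_neighbours)
      moreover have "H `` {x} \<subseteq> ?E `` {x}"
        by (auto simp: H_def)
      ultimately show ?thesis
        using card_mono[OF fin] le_trans by blast
    qed
  qed
  obtain ps where ps: "path_in H ps" "set ps \<subseteq> pverts G" "u \<in> set ps" "H `` set ps \<subseteq> set ps"
    using closed_path_exists[OF pair_finite_verts HV H_sym uv(1) H_degree] .
  obtain qs where qs: "path_in H qs" "set qs \<subseteq> pverts G" "v \<in> set qs" "H `` set qs \<subseteq> set qs"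
    using closed_path_exists[OF pair_finite_verts HV H_sym uv(2) H_degree] .
  have "H \<subseteq> ?E"
    by (auto simp: H_def)
  then have paths: "path_in ?E ps" "path_in ?E qs"
    using ps(1) qs(1) by (auto intro: path_in_mono)
  have induced: "induced_path G ps" "induced_path G qs"
    using tree_path_induced[OF assms(1,2)] paths ps(2) qs(2) by auto
  have v_notin: "v \<notin> set ps"
  proof
    assume "v \<in> set ps"
    then obtain i j where ij: "i < length ps" "ps ! i = u" "j < length ps" "ps ! j = v"
      using ps(3) by (auto simp: in_set_conv_nth)
    then have "j = Suc i \<or> i = Suc j"
      using induced(1) assms(3) by (auto simp: induced_path_def)
    then have "(u, v) \<in> H \<or> (v, u) \<in> H"
      using path_in_nth[OF ps(1)] ij by auto
    then show False
      by (auto simp: H_def)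
  qed
  \<comment> \<open>Both vertex sets are components after the deletion, so a common vertex would put
    \<open>v\<close> on the path of \<open>u\<close>.\<close>
  have disjoint: "set ps \<inter> set qs = {}"
    using path_in_subset_closed[OF qs(1) H_sym _ _ ps(4)] qs(3) v_notin by blast
  have cover: "set ps \<union> set qs = pverts G"
  proof
    have "?E `` (set ps \<union> set qs) \<subseteq> set ps \<union> set qs"
      using ps(3,4) qs(3,4) by (auto simp: H_def)
    then show "pverts G \<subseteq> set ps \<union> set qs"
      using undirected_tree_connected[OF assms(1,2), of u] ps(3) uv(1) by blast
  qed (use ps(2) qs(2) in blast)
  have "length ps + length qs = card (pverts G)"
    using cover disjoint paths
    by (simp add: path_in_def card_Un_disjoint distinct_card flip: cover)
  moreover have "noncrossing G ps qs"
  proof -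
    have crossing: "ps ! i = u \<and> qs ! j = v"
      if "i < length ps" "j < length qs" "adjacent G (ps ! i) (qs ! j)" for i j
      using unique_crossing_edge[OF undirected_tree_circuit_free[OF assms(1,2)] sym
          paths disjoint ps(3) qs(3) assms(3) nth_mem[OF that(1)] nth_mem[OF that(2)] that(3)] .
    have "distinct ps"
      using paths by (simp add: path_in_def)
    then have "i = x"
      if "i < length ps" "j < length qs" "adjacent G (ps ! i) (qs ! j)"
        and "x < length ps" "y < length qs" "adjacent G (ps ! x) (qs ! y)" for i j x y
      using crossing[OF that(1-3)] crossing[OF that(4-6)] nth_eq_iff_index_eq[OF _ that(1,4)] by simp
    then show ?thesis
      unfolding noncrossing_def by blast
  qed
  ultimately show ?thesis
    using induced disjoint unfolding two_parallel_paths_def by blast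
qed

theorem theorem4p1:
  fixes G :: "'a pair_pre_digraph"
  assumes "pair_graph G" and "undirected_tree G"
  shows "two_parallel_paths G \<longleftrightarrow>
    (\<not> (\<exists>v\<in>pverts G. vertex_degree G v \<ge> 4)) \<and>
    card {v \<in> pverts G. vertex_degree G v = 3} \<le> 2 \<and>
    (\<forall>u\<in>pverts G. \<forall>v\<in>pverts G.
       u \<noteq> v \<and> vertex_degree G u = 3 \<and> vertex_degree G v = 3 \<longrightarrow> adjacent G u v)"
proof -
  interpret pair_graph G by fact
  let ?D = "{v \<in> pverts G. vertex_degree G v = 3}"
  note sym = pair_graph_sym_irrefl(1)[OF assms(1)]
  show ?thesis
  proof (intro iffI conjI)
    assume "two_parallel_paths G"
    then consider "\<forall>x\<in>pverts G. vertex_degree G x \<le> 2"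
      | a b where "(a, b) \<in> parcs G" "\<forall>x\<in>pverts G. vertex_degree G x \<le> 3" "?D \<subseteq> {a, b}"
      using two_parallel_paths_degrees[OF assms] by blast
    \<comment> \<open>Both alternatives confine the vertices of degree three to a pair \<open>a\<close>, \<open>b\<close>, which is
      arbitrary when there are none.\<close>
    then have "(\<forall>x\<in>pverts G. vertex_degree G x \<le> 3) \<and>
      (\<exists>a b. ?D \<subseteq> {a, b} \<and> (a \<noteq> b \<and> ?D \<noteq> {} \<longrightarrow> (a, b) \<in> parcs G))"
    proof cases
      case 1
      then have "?D = {}"
        by fastforce
      then show ?thesis
        using 1 by fastforce
    next
      case (2 a b)
      then show ?thesis
        by blast
    qed
    then obtain a b where le_3: "\<forall>x\<in>pverts G. vertex_degree G x \<le> 3"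
      and D: "?D \<subseteq> {a, b}" and ab: "a \<noteq> b \<and> ?D \<noteq> {} \<longrightarrow> (a, b) \<in> parcs G"
      by blast
    show "\<not> (\<exists>v\<in>pverts G. vertex_degree G v \<ge> 4)"
      using le_3 by fastforce
    have "card ?D \<le> card {a, b}"
      using D by (intro card_mono) auto
    also have "\<dots> \<le> 2"
      by (simp add: card_insert_if)
    finally show "card ?D \<le> 2" .
    show "\<forall>u\<in>pverts G. \<forall>v\<in>pverts G.
       u \<noteq> v \<and> vertex_degree G u = 3 \<and> vertex_degree G v = 3 \<longrightarrow> adjacent G u v"
    proof (intro ballI impI)
      fix u v assume "u \<in> pverts G" "v \<in> pverts G"
        "u \<noteq> v \<and> vertex_degree G u = 3 \<and> vertex_degree G v = 3"
      then have "u \<in> ?D" "v \<in> ?D" "u \<noteq> v"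
        by auto
      then show "adjacent G u v"
        using D ab sym by (auto dest: symD)
    qed
  next
    assume conds: "(\<not> (\<exists>v\<in>pverts G. vertex_degree G v \<ge> 4)) \<and> card ?D \<le> 2 \<and>
      (\<forall>u\<in>pverts G. \<forall>v\<in>pverts G.
         u \<noteq> v \<and> vertex_degree G u = 3 \<and> vertex_degree G v = 3 \<longrightarrow> adjacent G u v)"
    have le_3: "vertex_degree G x \<le> 3" if "x \<in> pverts G" for x
      using conds that by fastforce
    show "two_parallel_paths G"
    proof (cases "?D = {}")
      case True
      then have "vertex_degree G x \<le> 2" if "x \<in> pverts G" for x
        using le_3[OF that] that by fastforce
      then show ?thesis
        using tree_degree_le_2_path_graph[OF assms] by (simp add: two_parallel_paths_def)
    next
      case False
      then obtain u where u: "u \<in> ?D"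
        by blast
      have "\<exists>v. (u, v) \<in> parcs G \<and> ?D \<subseteq> {u, v}"
      proof (cases "?D = {u}")
        case True
        \<comment> \<open>With a single vertex of degree three, any edge at it may be deleted.\<close>
        have "parcs G `` {u} \<noteq> {}"
          using u by (auto simp: vertex_degree_eq_card_neighbours)
        then show ?thesis
          using True by auto
      next
        case False
        then obtain v where v: "v \<in> ?D" "v \<noteq> u"
          using u by blast
        have "card {u, v} = 2"
          using v by simp
        then have "?D = {u, v}"
          using card_seteq[of ?D "{u, v}"] conds u v pair_finite_verts by auto
        moreover have "(u, v) \<in> parcs G"
          using conds u v by auto
        ultimately show ?thesis
          by blast
      qed
      then obtain v where "(u, v) \<in> parcs G" "?D \<subseteq> {u, v}"
        by blast
      then show ?thesis
        using tree_degree_3_on_edge_two_parallel_paths[OF assms, of u v] le_3 by blast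
    qed
  qed
qed

end
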